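(* Let $n\ge 3$. If $n$ is even, then $\mathcal P_{n+1}\cong\mathbf 2\times\mathcal P_n$ as posets. If $n$ is odd, then $\mathcal P_{n+1}\cong(\mathbf 2\times\mathcal P_n)\setminus(\{2\}\times\mathcal P_{n,\lfloor\frac{n-1}{2}\rfloor-1})$, where the right-hand side is the induced subposet of $\mathbf 2\times\mathcal P_n$ on the indicated set.
   Context: $[n]=\{1,\dots,n\}$; $\mathfrak S_n$ is the set of permutations of $[n]$ in one-line notation. The circular peak set of $\sigma\in\mathfrak S_n$ is $CP(\sigma)=\{\sigma(i)\mid 2\le i\le n-1,\ \sigma(i-1)<\sigma(i)>\sigma(i+1)\}$; for $S\subseteq[n]$, $CP_n(S)=\{\sigma\in\mathfrak S_n\mid CP(\sigma)=S\}$, and $\mathcal P_n=\{S\subseteq[n]\mid CP_n(S)\neq\emptyset\}$, a poset under inclusion. $\mathcal P_{n,i}=\{S\in\mathcal P_n\mid |S|=i+1\}$. $\mathbf 2$ is the poset $\{1,2\}$ with $1<2$, and for posets $P,Q$ the direct product $P\times Q$ has $(x,y)\le(x',y')$ iff $x\le x'$ in $P$ and $y\le y'$ in $Q$. *)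

theory Defs
  imports "HOL-Combinatorics.Permutations" "HOL-Library.Product_Order"
begin

definition circular_peaks :: "nat \<Rightarrow> (nat \<Rightarrow> nat) \<Rightarrow> nat set" where
  "circular_peaks n \<sigma> =
     {\<sigma> i | i. 2 \<le> i \<and> i \<le> n - 1 \<and> \<sigma> (i - 1) < \<sigma> i \<and> \<sigma> i > \<sigma> (i + 1)}"

definition perms_with_peaks :: "nat \<Rightarrow> nat set \<Rightarrow> (nat \<Rightarrow> nat) set" where
  "perms_with_peaks n S = {\<sigma>. \<sigma> permutes {1..n} \<and> circular_peaks n \<sigma> = S}"

definition peak_poset :: "nat \<Rightarrow> nat set set" where
  "peak_poset n = {S. S \<subseteq> {1..n} \<and> perms_with_peaks n S \<noteq> {}}"

text \<open>The index is an integer, so that the empty set is covered, as the level of index \<open>-1\<close>.\<close>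

definition peak_poset_level :: "nat \<Rightarrow> int \<Rightarrow> nat set set" where
  "peak_poset_level n i = {S \<in> peak_poset n. int (card S) = i + 1}"

text \<open>
  A poset is represented by its carrier, a subset of a type of class \<^class>\<open>order\<close>,
  and carries the order induced from that type: inclusion on \<open>nat set\<close>, the usual order
  on \<open>nat\<close>, and the componentwise order of \<open>Product_Order\<close> on pairs.
\<close>

definition poset_isomorphic :: "'a::order set \<Rightarrow> 'b::order set \<Rightarrow> bool" (infix "\<cong>\<^sub>P" 50) where
  "A \<cong>\<^sub>P B \<longleftrightarrow>
     (\<exists>f. bij_betw f A B \<and> (\<forall>x\<in>A. \<forall>y\<in>A. x \<le> y \<longleftrightarrow> f x \<le> f y))"

abbreviation two_poset :: "nat set" where
  "two_poset \<equiv> {1, 2}"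

end

theory Submission
  imports Defs
begin

text \<open>
  A set \<open>S = {s\<^sub>1 < \<dots> < s\<^sub>k} \<subseteq> {1..n}\<close> is a peak set iff \<open>s\<^sub>j \<ge> 2 j + 1\<close> for all \<open>j\<close>.
  This is necessary because the positions of \<open>s\<^sub>1, \<dots>, s\<^sub>j\<close> are pairwise non-adjacent, so that
  together with their right neighbours and the left neighbour of the first one they form
  \<open>2 j + 1\<close> positions holding values at most \<open>s\<^sub>j\<close>. Conversely, if \<open>t\<^sub>1 < t\<^sub>2 < \<dots>\<close> are
  the other elements of \<open>{1..n}\<close>, then \<open>t\<^bsub>j+1\<^esub> < s\<^sub>j\<close>, and
  \<open>t\<^sub>1 s\<^sub>1 t\<^sub>2 s\<^sub>2 \<dots> t\<^sub>k s\<^sub>k t\<^bsub>k+1\<^esub> t\<^bsub>k+2\<^esub> \<dots>\<close> has peak set \<open>S\<close>.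
  By this criterion \<open>n + 1\<close> can be added to a peak set \<open>S\<close> in \<open>{1..n}\<close> iff
  \<open>2 |S| + 2 \<le> n\<close>, which fails only for odd \<open>n\<close> and \<open>|S|\<close> maximal.
\<close>

section \<open>Necessity of the bound on peak sets\<close>

lemma peak_set_bound:
  assumes perm: "\<sigma> permutes {1..n}" and m: "m \<in> circular_peaks n \<sigma>"
  shows "2 * card (circular_peaks n \<sigma> \<inter> {..m}) < m"
proof -
  define P where
    "P = {i. 2 \<le> i \<and> i \<le> n - 1 \<and> \<sigma> (i - 1) < \<sigma> i \<and> \<sigma> i > \<sigma> (i + 1) \<and> \<sigma> i \<le> m}"
  have img: "circular_peaks n \<sigma> \<inter> {..m} = \<sigma> ` P"
    by (auto simp: circular_peaks_def P_def)
  have inj: "inj \<sigma>" by (rule permutes_inj[OF perm])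
  have finP: "finite P" by (rule finite_subset[of _ "{..n}"]) (auto simp: P_def)
  have neP: "P \<noteq> {}" using m img by auto
  define a where "a = Min P"
  have aP: "a \<in> P" and amin: "\<And>i. i \<in> P \<Longrightarrow> a \<le> i"
    using finP neP by (auto simp: a_def)
  have "2 \<le> a" using aP by (simp add: P_def)
  have nonadj: "Suc i \<notin> P" if "i \<in> P" for i
    using that by (auto simp: P_def)
  define Q where "Q = insert (a - 1) (P \<union> Suc ` P)"
  \<comment> \<open>Membership of \<open>a - 1\<close> in \<open>P\<close>, or of its predecessor,
    would contradict the minimality of \<open>a\<close>.\<close>
  have "a - 1 \<notin> P \<union> Suc ` P"
    using amin \<open>2 \<le> a\<close> by fastforce
  moreover have "P \<inter> Suc ` P = {}" using nonadj by auto
  ultimately have cQ: "card Q = Suc (2 * card P)"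
    using finP by (simp add: Q_def card_Un_disjoint card_image)
  have "\<sigma> ` Q \<subseteq> {1..m}"
  proof
    fix x assume "x \<in> \<sigma> ` Q"
    then obtain q where q: "q \<in> Q" "x = \<sigma> q" by auto
    from q(1) consider "q = a - 1" | "q \<in> P" | p where "p \<in> P" "q = Suc p"
      by (auto simp: Q_def)
    \<comment> \<open>Neighbours of a peak have smaller values, and
      \<open>2 \<le> i \<le> n - 1\<close> keeps them inside \<open>{1..n}\<close>.\<close>
    then have "q \<in> {1..n} \<and> x \<le> m"
      using q(2) aP by cases (auto simp: P_def)
    then show "x \<in> {1..m}" using permutes_in_image[OF perm, of q] q(2) by simp
  qed
  then have "card (\<sigma> ` Q) \<le> m"
    using card_mono[of "{1..m}" "\<sigma> ` Q"] by simp
  then have "card Q \<le> m"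
    using inj by (simp add: card_image inj_on_subset)
  moreover have "card (\<sigma> ` P) = card P"
    using inj by (simp add: card_image inj_on_subset)
  ultimately show ?thesis using cQ img by simp
qed

section \<open>Sufficiency: realising a set by a permutation\<close>

text \<open>Translates between counting elements up to a bound and positions in the increasing
  listings of \<open>S\<close> and its complement; indices start at 0.\<close>

lemma card_initial_segment:
  fixes xs :: "'a::linorder list"
  assumes "sorted_wrt (<) xs" "j < length xs"
  shows "card (set xs \<inter> {..xs ! j}) = Suc j"
proof -
  have less: "xs ! p < xs ! q" if "p < q" "q < length xs" for p q
    using assms(1) that by (auto simp: sorted_wrt_iff_nth_less)
  have "set xs \<inter> {..xs ! j} = (!) xs ` {..j}" (is "?A = ?B")
  proof
    show "?A \<subseteq> ?B"
      using less[of j] by (force simp: in_set_conv_nth not_less[symmetric])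
    show "?B \<subseteq> ?A"
      using less[of _ j] assms(2) by (auto simp: le_less)
  qed
  moreover have "inj_on ((!) xs) {..j}"
    using less assms(2) by (intro linorder_inj_onI) (force dest: less_imp_neq)+
  ultimately show ?thesis by (simp add: card_image)
qed

text \<open>For \<open>m = xs ! j\<close>, exactly \<open>j + 1\<close> elements of
  \<open>{1..m}\<close> lie in \<open>S\<close>, and the bound gives
  \<open>m \<ge> 2 * j + 3\<close>, so at least \<open>j + 2\<close> lie outside.\<close>

lemma complement_nth_less:
  assumes S: "S \<subseteq> {1..n}" and bound: "\<And>m. m \<in> S \<Longrightarrow> 2 * card (S \<inter> {..m}) < m"
    and xs: "sorted_wrt (<) xs" "set xs = S"
    and ys: "sorted_wrt (<) ys" "set ys = {1..n} - S"
    and j: "j < length xs"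
  shows "Suc j < length ys \<and> ys ! Suc j < xs ! j"
proof -
  define m where "m = xs ! j"
  have mS: "m \<in> S" using j xs by (auto simp: m_def)
  have cS: "card (S \<inter> {..m}) = Suc j"
    using card_initial_segment[OF xs(1) j] xs(2) by (simp add: m_def)
  have "m \<le> n" using S mS by auto
  then have "{1..m} = {1..n} \<inter> {..m}" by auto
  also have "\<dots> = (S \<inter> {..m}) \<union> (set ys \<inter> {..m})"
    unfolding ys(2) using S by blast
  finally have "{1..m} = (S \<inter> {..m}) \<union> (set ys \<inter> {..m})" .
  then have "card {1..m} = card ((S \<inter> {..m}) \<union> (set ys \<inter> {..m}))"
    by (rule arg_cong)
  also have "\<dots> = card (S \<inter> {..m}) + card (set ys \<inter> {..m})"
    unfolding ys(2) by (rule card_Un_disjoint) auto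
  finally have "m = card (S \<inter> {..m}) + card (set ys \<inter> {..m})" by simp
  then have cT: "Suc (Suc j) \<le> card (set ys \<inter> {..m})"
    using bound[OF mS] cS by simp
  also have "\<dots> \<le> card (set ys)" by (rule card_mono) auto
  also have "\<dots> \<le> length ys" by (rule card_length)
  finally have len: "Suc j < length ys" by simp
  have "ys ! Suc j < m"
  proof (rule ccontr)
    \<comment> \<open>Otherwise \<open>ys ! Suc j\<close> comes on top of the \<open>j + 2\<close>
      or more entries up to \<open>m\<close>, although its own initial segment has only
      \<open>j + 2\<close> elements.\<close>
    assume nless: "\<not> ys ! Suc j < m"
    have "ys ! Suc j \<in> set ys" using len by (rule nth_mem)
    moreover have "m \<notin> set ys" using mS ys(2) by simp
    ultimately have "ys ! Suc j \<noteq> m" by metis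
    with nless have "m < ys ! Suc j" by simp
    then have "ys ! Suc j \<notin> set ys \<inter> {..m}"
      and "set ys \<inter> {..m} \<subseteq> set ys \<inter> {..ys ! Suc j}" by auto
    moreover have "ys ! Suc j \<in> set ys \<inter> {..ys ! Suc j}"
      using \<open>ys ! Suc j \<in> set ys\<close> by simp
    ultimately have "set ys \<inter> {..m} \<subset> set ys \<inter> {..ys ! Suc j}" by blast
    then have "card (set ys \<inter> {..m}) < card (set ys \<inter> {..ys ! Suc j})"
      by (intro psubset_card_mono) auto
    with cT card_initial_segment[OF ys(1) len] show False by simp
  qed
  with len show ?thesis by (simp add: m_def)
qed

lemma peak_set_exists:
  assumes S: "S \<subseteq> {1..n}" and bound: "\<And>m. m \<in> S \<Longrightarrow> 2 * card (S \<inter> {..m}) < m"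
  shows "\<exists>\<sigma>. \<sigma> permutes {1..n} \<and> circular_peaks n \<sigma> = S"
proof -
  define xs ys where "xs = sorted_list_of_set S" and "ys = sorted_list_of_set ({1..n} - S)"
  have finS: "finite S" using S finite_subset by blast
  have xs: "sorted_wrt (<) xs" "set xs = S"
    and ys: "sorted_wrt (<) ys" "set ys = {1..n} - S"
    using finS by (simp_all add: xs_def ys_def strict_sorted_list_of_set)
  define k where "k = length xs"
  have len: "length ys = n - k" "k \<le> n"
    using finS S card_mono[of "{1..n}" S] by (simp_all add: xs_def ys_def k_def card_Diff_subset)
  have below: "Suc j < length ys \<and> ys ! Suc j < xs ! j" if "j < k" for j
    using complement_nth_less[OF S bound xs ys] that by (simp add: k_def)
  have ys_mono: "ys ! p < ys ! q" if "p < q" "q < length ys" for p q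
    using ys(1) that by (auto simp: sorted_wrt_iff_nth_less)
  \<comment> \<open>The last peak goes to position \<open>2 * k\<close>; strictness leaves room for
    its right neighbour.\<close>
  have k_bound: "2 * k < n" if "0 < k"
    using below[of "k - 1"] that len by auto
  \<comment> \<open>Zero-based lists meet one-based positions: \<open>xs ! j\<close> sits at
    \<open>2 * j + 2\<close> and, for \<open>j < k\<close>, \<open>ys ! j\<close> at
    \<open>2 * j + 1\<close>. In the tail all \<open>k\<close> elements of \<open>S\<close> have
    been placed, hence the shift by \<open>k + 1\<close>.\<close>
  define \<sigma> where "\<sigma> i = (if i \<in> {1..n} then
      if i \<le> 2 * k then if even i then xs ! (i div 2 - 1) else ys ! (i div 2)
      else ys ! (i - k - 1) else i)" for i
  have sigma_even: "\<sigma> (2 * Suc j) = xs ! j" if "j < k" for j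
    using that k_bound by (auto simp: \<sigma>_def)
  have sigma_odd: "\<sigma> (Suc (2 * j)) = ys ! j" if "j < k" for j
    using that k_bound by (auto simp: \<sigma>_def)
  have sigma_tail: "\<sigma> (j + k + 1) = ys ! j" if "k \<le> j" "j + k < n" for j
    using that by (auto simp: \<sigma>_def)
  \<comment> \<open>Surjectivity suffices, since \<open>{1..n}\<close> is finite.\<close>
  have "{1..n} \<subseteq> \<sigma> ` {1..n}"
  proof
    fix v assume v: "v \<in> {1..n}"
    show "v \<in> \<sigma> ` {1..n}"
    proof (cases "v \<in> S")
      case True
      then obtain j where j: "j < k" "v = xs ! j"
        using xs by (auto simp: k_def in_set_conv_nth)
      then show ?thesis
        using sigma_even[OF j(1)] k_bound by (intro image_eqI[of _ _ "2 * Suc j"]) auto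
    next
      case False
      then obtain j where j: "j < n - k" "v = ys ! j"
        using ys v len by (metis DiffI in_set_conv_nth)
      show ?thesis
      proof (cases "j < k")
        case True
        then show ?thesis
          using sigma_odd[of j] k_bound j by (intro image_eqI[of _ _ "Suc (2 * j)"]) auto
      next
        case False
        then show ?thesis
          using sigma_tail[of j] j by (intro image_eqI[of _ _ "j + k + 1"]) auto
      qed
    qed
  qed
  then have eq: "\<sigma> ` {1..n} = {1..n}"
    by (metis card_image_le card_seteq finite_atLeastAtMost finite_imageI)
  then have "bij_betw \<sigma> {1..n} {1..n}"
    by (simp add: bij_betw_def eq_card_imp_inj_on)
  then have perm: "\<sigma> permutes {1..n}"
    by (rule bij_imp_permutes) (simp only: \<sigma>_def if_False)
  have "circular_peaks n \<sigma> = S"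
  proof
    show "S \<subseteq> circular_peaks n \<sigma>"
    proof
      fix v assume "v \<in> S"
      then obtain j where j: "j < k" "v = xs ! j"
        using xs by (auto simp: k_def in_set_conv_nth)
      have left: "\<sigma> (2 * Suc j - 1) = ys ! j"
        using sigma_odd[OF j(1)] by simp
      \<comment> \<open>After the last peak the right neighbour is the first entry of the
        tail.\<close>
      have right: "\<sigma> (2 * Suc j + 1) = ys ! Suc j"
      proof (cases "Suc j < k")
        case True
        then show ?thesis using sigma_odd[OF True] by simp
      next
        case False
        then have "k = Suc j" using j by simp
        then show ?thesis using sigma_tail[of "Suc j"] k_bound by (simp add: mult_2)
      qed
      have "ys ! j < xs ! j" "ys ! Suc j < xs ! j"
        using below[OF j(1)] ys_mono[of j "Suc j"] by auto
      then have "v = \<sigma> (2 * Suc j) \<and> 2 \<le> 2 * Suc j \<and> 2 * Suc j \<le> n - 1 \<and>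
          \<sigma> (2 * Suc j - 1) < \<sigma> (2 * Suc j) \<and> \<sigma> (2 * Suc j) > \<sigma> (2 * Suc j + 1)"
        using left right sigma_even[OF j(1)] k_bound j by auto
      then show "v \<in> circular_peaks n \<sigma>"
        unfolding circular_peaks_def by blast
    qed
    show "circular_peaks n \<sigma> \<subseteq> S"
    proof
      fix v assume "v \<in> circular_peaks n \<sigma>"
      then obtain i where i: "v = \<sigma> i" "2 \<le> i" "i \<le> n - 1" "\<sigma> i > \<sigma> (i + 1)"
        by (auto simp: circular_peaks_def)
      \<comment> \<open>The tail is increasing, so no descent starts there.\<close>
      have "i \<le> 2 * k"
      proof (rule ccontr)
        assume "\<not> i \<le> 2 * k"
        moreover have "i + 1 \<le> n" using i by simp
        ultimately have "\<sigma> i = ys ! (i - k - 1)" "\<sigma> (i + 1) = ys ! (i - k)"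
          by (simp_all add: \<sigma>_def)
        moreover have "ys ! (i - k - 1) < ys ! (i - k)"
          using \<open>\<not> i \<le> 2 * k\<close> i len by (intro ys_mono) auto
        ultimately show False using i by simp
      qed
      show "v \<in> S"
      proof (cases "even i")
        case True
        then obtain q where "i = 2 * q" by (rule evenE)
        then obtain j where "i = 2 * Suc j"
          using i(2) by (cases q) auto
        then have "j < k" using \<open>i \<le> 2 * k\<close> by simp
        then show ?thesis
          using sigma_even[of j] i(1) \<open>i = 2 * Suc j\<close> xs by (auto simp: k_def)
      next
        case False
        then obtain j where j: "i = Suc (2 * j)" by (metis oddE Suc_eq_plus1)
        then have "j < k" using \<open>i \<le> 2 * k\<close> by simp
        \<comment> \<open>An odd position of the alternating part is followed by an ascent.\<close>
        moreover have "ys ! j < xs ! j"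
          using below[OF \<open>j < k\<close>] ys_mono[of j "Suc j"] by auto
        ultimately show ?thesis
          using sigma_even[of j] sigma_odd[of j] i(4) j by simp
      qed
    qed
  qed
  with perm show ?thesis by blast
qed

section \<open>The criterion and the passage from \<open>n\<close> to \<open>n + 1\<close>\<close>

lemma peak_poset_iff:
  "S \<in> peak_poset n \<longleftrightarrow> S \<subseteq> {1..n} \<and> (\<forall>m\<in>S. 2 * card (S \<inter> {..m}) < m)"
  using peak_set_bound peak_set_exists
  by (auto simp: peak_poset_def perms_with_peaks_def)

text \<open>This is the criterion at the largest element of \<open>S\<close>.\<close>

lemma peak_poset_card:
  assumes "S \<in> peak_poset n" "0 < n"
  shows "2 * card S < n"
proof (cases "S = {}")
  case False
  have S: "S \<subseteq> {1..n}" and fin: "finite S"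
    using assms finite_subset by (auto simp: peak_poset_iff)
  have "S \<inter> {..Max S} = S" using fin by auto
  moreover have "Max S \<in> S" using fin False by simp
  ultimately show ?thesis
    using assms S by (force simp: peak_poset_iff)
qed (use assms in simp)

text \<open>The criterion depends on \<open>n\<close> only through
  \<open>S \<subseteq> {1..n}\<close>.\<close>

lemma peak_poset_Suc_same:
  assumes "Suc n \<notin> S"
  shows "S \<in> peak_poset (Suc n) \<longleftrightarrow> S \<in> peak_poset n"
  using assms by (auto simp: peak_poset_iff atLeastAtMostSuc_conv)

text \<open>The new element leaves the counts at all \<open>m \<in> S\<close> unchanged; its own
  condition reads \<open>2 * (card S + 1) < n + 1\<close>.\<close>

lemma peak_poset_Suc_insert:
  assumes "S \<subseteq> {1..n}"
  shows "insert (Suc n) S \<in> peak_poset (Suc n) \<longleftrightarrow> S \<in> peak_poset n \<and> 2 * card S + 2 \<le> n"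
proof -
  have "finite S" "Suc n \<notin> S" using assms finite_subset by auto
  moreover have "insert (Suc n) S \<inter> {..m} = S \<inter> {..m}" if "m \<in> S" for m
    using assms that by auto
  moreover have "insert (Suc n) S \<inter> {..Suc n} = insert (Suc n) S"
    using assms by auto
  moreover have "insert (Suc n) S \<subseteq> {1..Suc n}"
    using assms by auto
  ultimately show ?thesis
    using assms by (simp add: peak_poset_iff Suc_le_eq conj_commute)
qed

text \<open>Treats both parities at once: the first coordinate records whether \<open>Suc n\<close>
  is a peak value, the second keeps the other peak values.\<close>

lemma peak_poset_Suc_isomorphic:
  "peak_poset (Suc n) \<cong>\<^sub>P {(a, S). a \<in> two_poset \<and> S \<in> peak_poset n \<and> (a = 2 \<longrightarrow> 2 * card S + 2 \<le> n)}"
    (is "_ \<cong>\<^sub>P ?B")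
proof -
  define f :: "nat set \<Rightarrow> nat \<times> nat set"
    where "f S = (if Suc n \<in> S then 2 else 1, S - {Suc n})" for S
  define g :: "nat \<times> nat set \<Rightarrow> nat set"
    where "g p = (if fst p = 2 then insert (Suc n) (snd p) else snd p)" for p
  have sub: "S \<subseteq> {1..n}" if "S \<in> peak_poset n" for S
    using that by (simp add: peak_poset_iff)
  have fB: "f S \<in> ?B" if "S \<in> peak_poset (Suc n)" for S
  proof (cases "Suc n \<in> S")
    case True
    have "S - {Suc n} \<subseteq> {1..n}"
      using that by (auto simp: peak_poset_iff atLeastAtMostSuc_conv)
    from peak_poset_Suc_insert[OF this] that True show ?thesis
      by (simp add: f_def insert_absorb)
  next
    case False
    then show ?thesis using that peak_poset_Suc_same by (simp add: f_def)
  qed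
  have gP: "g p \<in> peak_poset (Suc n)" if "p \<in> ?B" for p
  proof -
    obtain a S where p: "p = (a, S)" by fastforce
    then have "S \<in> peak_poset n" using that by simp
    moreover from this have "S \<subseteq> {1..n}" "Suc n \<notin> S" using sub[of S] by auto
    ultimately show ?thesis
      using that p by (auto simp: g_def peak_poset_Suc_insert peak_poset_Suc_same)
  qed
  have fg: "f (g p) = p" if "p \<in> ?B" for p
    using that sub by (fastforce simp: f_def g_def)
  have gf: "g (f S) = S" for S
    by (auto simp: f_def g_def)
  have "bij_betw f (peak_poset (Suc n)) ?B"
  proof (rule bij_betw_byWitness[where f' = g])
    show "\<forall>S\<in>peak_poset (Suc n). g (f S) = S" using gf by simp
    show "\<forall>p\<in>?B. f (g p) = p" using fg by (intro ballI)
    show "f ` peak_poset (Suc n) \<subseteq> ?B" using fB by (rule image_subsetI)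
    show "g ` ?B \<subseteq> peak_poset (Suc n)" using gP by (rule image_subsetI)
  qed
  \<comment> \<open>Inclusion can be tested separately at \<open>Suc n\<close> and on the remaining
    elements.\<close>
  moreover have "S \<le> T \<longleftrightarrow> f S \<le> f T" for S T
    by (auto simp: f_def less_eq_prod_def)
  ultimately show ?thesis
    unfolding poset_isomorphic_def by blast
qed

theorem theorem3p3:
  fixes n :: nat
  assumes "n \<ge> 3"
  shows "(even n \<longrightarrow> peak_poset (n + 1) \<cong>\<^sub>P two_poset \<times> peak_poset n) \<and>
         (odd n \<longrightarrow> peak_poset (n + 1) \<cong>\<^sub>P
            (two_poset \<times> peak_poset n) - ({2} \<times> peak_poset_level n ((int n - 1) div 2 - 1)))"
proof -
  let ?B = "{(a, S). a \<in> two_poset \<and> S \<in> peak_poset n \<and> (a = 2 \<longrightarrow> 2 * card S + 2 \<le> n)}"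
  have card: "2 * card S < n" if "S \<in> peak_poset n" for S
    using peak_poset_card[OF that] assms by simp
  have even_case: "?B = two_poset \<times> peak_poset n" if "even n"
  proof -
    \<comment> \<open>Two even numbers in strict order differ by at least 2.\<close>
    have "2 * card S + 2 \<le> n" if "S \<in> peak_poset n" for S
      using card[OF that] \<open>even n\<close> by presburger
    then show ?thesis by auto
  qed
  have odd_case: "?B = (two_poset \<times> peak_poset n) -
      ({2} \<times> peak_poset_level n ((int n - 1) div 2 - 1))" if "odd n"
  proof -
    from \<open>odd n\<close> obtain k where k: "n = 2 * k + 1" by (rule oddE)
    \<comment> \<open>The level has index \<open>k - 1\<close>, so its sets have \<open>k\<close>
      elements, the largest size that \<open>2 * card S < 2 * k + 1\<close> allows.\<close>
    have "2 * card S + 2 \<le> n \<longleftrightarrow> S \<notin> peak_poset_level n ((int n - 1) div 2 - 1)"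
      if "S \<in> peak_poset n" for S
      using that card[OF that] by (auto simp: peak_poset_level_def k)
    then show ?thesis by auto
  qed
  show ?thesis
    unfolding Suc_eq_plus1[symmetric]
  proof (intro conjI impI)
    show "peak_poset (Suc n) \<cong>\<^sub>P two_poset \<times> peak_poset n" if "even n"
      using peak_poset_Suc_isomorphic[of n] unfolding even_case[OF that] .
    show "peak_poset (Suc n) \<cong>\<^sub>P (two_poset \<times> peak_poset n) -
        ({2} \<times> peak_poset_level n ((int n - 1) div 2 - 1))" if "odd n"
      using peak_poset_Suc_isomorphic[of n] unfolding odd_case[OF that] .
  qed
qed

end
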